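(* Let $K$ be a Chebyshev set in a complex normed space $X$, and suppose that the metric projection $P_K:X\to X$ is a bi-potent map. Then the following statements are true. (1) $0\in K$. (2) For every $x\in K^c$, $x-P_K(x)\in K^c$, where $K^c=X\setminus K$ denotes the complement of $K$. (3) $0\notin \mathrm{int}(K)$, the interior of $K$. (4) $0\in \mathrm{Bdr}(K)$, the boundary of $K$. (5) If $K$ is complete and convex, then $K$ is not totally bounded.
   Context: For a non-empty subset $K$ of a normed linear space $X$ and $x\in X$, put $P_K(x)=\{y\in K:\|x-y\|=\mathrm{dist}(x,K)\}$, where $\mathrm{dist}(x,K)=\inf_{y\in K}\|x-y\|$. The set $K$ is called Chebyshev if $P_K(x)$ contains exactly one point for every $x\in X$; in that case $P_K$ is regarded as a single-valued map $X\to X$, called the metric projection of $X$ onto $K$. A map $P:X\to X$ is idempotent if $P^2=P\circ P=P$ (no linearity or continuity is assumed), and bi-potent if both $P$ and $I-P$ are idempotent, where $I$ is the identity map on $X$ and $(I-P)(x)=x-P(x)$.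
   Formalization: Parts (3) and (4) are stated for K ≠ X and part (5) for K ≠ {0}: for K = X the projection is the identity and 0 is interior to K, and K = {0} is complete, convex and totally bounded, so these parts fail there. *)

theory Defs
  imports "HOL-Analysis.Analysis"
begin

text \<open>Complex normed spaces. The library only has real ones, so complex scalar multiplication
  is added on top of \<^class>\<open>real_normed_vector\<close>; the last axiom makes the
  underlying real structure the restriction of the complex one.\<close>

class complex_normed_vector = real_normed_vector +
  fixes scaleC :: "complex \<Rightarrow> 'a \<Rightarrow> 'a"
  assumes scaleC_add_right: "scaleC a (x + y) = scaleC a x + scaleC a y"
    and scaleC_add_left: "scaleC (a + b) x = scaleC a x + scaleC b x"
    and scaleC_scaleC: "scaleC a (scaleC b x) = scaleC (a * b) x"
    and scaleC_one: "scaleC 1 x = x"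
    and norm_scaleC: "norm (scaleC a x) = cmod a * norm x"
    and scaleR_scaleC: "scaleR r x = scaleC (complex_of_real r) x"

instantiation complex :: complex_normed_vector
begin

definition scaleC_complex :: "complex \<Rightarrow> complex \<Rightarrow> complex" where
  "scaleC_complex a x = a * x"

instance
  by standard (simp_all add: scaleC_complex_def algebra_simps norm_mult scaleR_conv_of_real)

end

definition nearest_points :: "'a::real_normed_vector set \<Rightarrow> 'a \<Rightarrow> 'a set" where
  "nearest_points K x = {y \<in> K. norm (x - y) = infdist x K}"

definition chebyshev :: "'a::real_normed_vector set \<Rightarrow> bool" where
  "chebyshev K \<longleftrightarrow> K \<noteq> {} \<and> (\<forall>x. \<exists>!y. y \<in> nearest_points K x)"

text \<open>Only meaningful if \<open>K\<close> is Chebyshev.\<close>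

definition metric_projection :: "'a::real_normed_vector set \<Rightarrow> 'a \<Rightarrow> 'a" where
  "metric_projection K x = (THE y. y \<in> nearest_points K x)"

definition idempotent_map :: "('a \<Rightarrow> 'a) \<Rightarrow> bool" where
  "idempotent_map P \<longleftrightarrow> P \<circ> P = P"

definition bipotent :: "('a::ab_group_add \<Rightarrow> 'a) \<Rightarrow> bool" where
  "bipotent P \<longleftrightarrow> idempotent_map P \<and> idempotent_map (\<lambda>x. x - P x)"

end

theory Submission
  imports Defs
begin

text \<open>
  Write \<open>P\<close> for the metric projection. It fixes exactly the points of \<open>K\<close>, and idempotence of
  \<open>I - P\<close> says precisely that \<open>P (x - P x) = 0\<close> for every \<open>x\<close> (lemma
  \<open>metric_projection_residual\<close>): the residuals all project to the origin. As \<open>P\<close> takes its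
  values in \<open>K\<close>, this puts \<open>0\<close> in \<open>K\<close>, and it shows that a residual lying in \<open>K\<close>, being both
  fixed and sent to \<open>0\<close>, must vanish. A point outside \<open>K\<close> thus has its residual outside \<open>K\<close>.

  A non-zero residual \<open>z\<close> has \<open>0\<close> as a nearest point, and by the triangle inequality so does every
  point of the segment from \<open>z\<close> to \<open>0\<close>. That segment therefore meets \<open>K\<close> only at \<open>0\<close>, so \<open>0\<close> is
  not interior to \<open>K\<close>.

  If \<open>K\<close> is complete and totally bounded, it is compact and has an element \<open>m\<close> of largest norm. Each
  \<open>k\<close> in \<open>K\<close> is at distance at least \<open>2 \<parallel>m\<parallel> - \<parallel>k\<parallel> \<ge> \<parallel>m\<parallel>\<close> from \<open>2 m\<close>, and \<open>m\<close> is at distance \<open>\<parallel>m\<parallel>\<close>,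
  so \<open>P (2 m) = m\<close>. Hence \<open>m\<close> is itself a residual belonging to \<open>K\<close>; it vanishes, and \<open>K = {0}\<close>.
\<close>

lemma nearest_pointsI:
  assumes "y \<in> K" and "\<And>k. k \<in> K \<Longrightarrow> norm (x - y) \<le> norm (x - k)"
  shows "y \<in> nearest_points K x"
proof -
  have "norm (x - y) \<le> infdist x K"
    using assms by (auto simp: infdist_def dist_norm intro!: cINF_greatest)
  moreover have "infdist x K \<le> norm (x - y)"
    using infdist_le[OF assms(1), of x] by (simp add: dist_norm)
  ultimately show ?thesis
    using assms(1) by (simp add: nearest_points_def)
qed

lemma nearest_pointsD:
  assumes "y \<in> nearest_points K x" and "k \<in> K"
  shows "norm (x - y) \<le> norm (x - k)"
  using assms infdist_le[OF assms(2), of x] by (simp add: nearest_points_def dist_norm)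

text \<open>Along the segment from \<open>x\<close> to one of its nearest points \<open>y\<close>, the distance to \<open>y\<close> decreases at
  unit speed, whereas the distance to any other point of \<open>K\<close> cannot decrease faster.\<close>

lemma nearest_points_segment:
  assumes "y \<in> nearest_points K x" and "0 \<le> t" "t \<le> 1"
  shows "y \<in> nearest_points K (y + t *\<^sub>R (x - y))"
proof (rule nearest_pointsI)
  show "y \<in> K"
    using assms(1) by (simp add: nearest_points_def)
next
  fix k assume "k \<in> K"
  have "norm (x - y) \<le> norm (x - k)"
    using nearest_pointsD[OF assms(1) \<open>k \<in> K\<close>] .
  also have "x - k = (y + t *\<^sub>R (x - y) - k) + (1 - t) *\<^sub>R (x - y)"
    by (simp add: algebra_simps)
  also have "norm \<dots> \<le> norm (y + t *\<^sub>R (x - y) - k) + (1 - t) * norm (x - y)"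
    using norm_triangle_ineq[of "y + t *\<^sub>R (x - y) - k" "(1 - t) *\<^sub>R (x - y)"] assms(3) by simp
  finally have "t * norm (x - y) \<le> norm (y + t *\<^sub>R (x - y) - k)"
    by (simp add: left_diff_distrib)
  then show "norm (y + t *\<^sub>R (x - y) - y) \<le> norm (y + t *\<^sub>R (x - y) - k)"
    using assms(2) by simp
qed

lemma metric_projection_nearest:
  assumes "chebyshev K"
  shows "metric_projection K x \<in> nearest_points K x"
  using assms theI'[of "\<lambda>y. y \<in> nearest_points K x"]
  by (simp add: chebyshev_def metric_projection_def)

lemma metric_projection_mem:
  assumes "chebyshev K"
  shows "metric_projection K x \<in> K"
  using metric_projection_nearest[OF assms, of x] by (simp add: nearest_points_def)

lemma metric_projection_eqI:
  assumes "chebyshev K" and "y \<in> nearest_points K x"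
  shows "metric_projection K x = y"
  using assms metric_projection_nearest[OF assms(1), of x] by (auto simp: chebyshev_def)

lemma metric_projection_id:
  assumes "chebyshev K" and "x \<in> K"
  shows "metric_projection K x = x"
  using assms by (intro metric_projection_eqI nearest_pointsI) auto

lemma metric_projection_residual:
  assumes "bipotent (metric_projection K)"
  shows "metric_projection K (x - metric_projection K x) = 0"
proof -
  have "(\<lambda>x. x - metric_projection K x) \<circ> (\<lambda>x. x - metric_projection K x)
    = (\<lambda>x. x - metric_projection K x)"
    using assms by (simp add: bipotent_def idempotent_map_def)
  from fun_cong[OF this, of x] show ?thesis
    by simp
qed

lemma residual_mem_imp_zero:
  assumes "chebyshev K" and "bipotent (metric_projection K)"
    and "x - metric_projection K x \<in> K"
  shows "x = metric_projection K x"
  using metric_projection_id[OF assms(1,3)] metric_projection_residual[OF assms(2), of x] by simp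

lemma zero_mem_bipotent:
  assumes "chebyshev K" and "bipotent (metric_projection K)"
  shows "0 \<in> K"
  using metric_projection_mem[OF assms(1)] metric_projection_residual[OF assms(2)] by metis

lemma zero_not_interior_bipotent:
  assumes "chebyshev K" and "bipotent (metric_projection K)" and "K \<noteq> UNIV"
  shows "0 \<notin> interior K"
proof
  assume "0 \<in> interior K"
  then obtain e where "e > 0" and ball: "ball 0 e \<subseteq> K"
    by (auto simp: mem_interior)
  obtain x where "x \<notin> K"
    using assms(3) by auto
  define z where "z = x - metric_projection K x"
  have "z \<noteq> 0"
    using \<open>x \<notin> K\<close> metric_projection_mem[OF assms(1), of x] by (auto simp: z_def)
  have "0 \<in> nearest_points K z"
    using metric_projection_nearest[OF assms(1), of z] metric_projection_residual[OF assms(2), of x]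
    by (simp add: z_def)
  \<comment> \<open>Scale \<open>z\<close> into the ball while staying on the segment from \<open>0\<close> to \<open>z\<close>; the factor \<open>2\<close> makes
    the norm strictly less than \<open>e\<close>.\<close>
  define t where "t = min 1 (e / (2 * norm z))"
  have "0 < t" "t \<le> 1"
    using \<open>e > 0\<close> \<open>z \<noteq> 0\<close> by (auto simp: t_def)
  have "t * norm z \<le> e / (2 * norm z) * norm z"
    unfolding t_def by (intro mult_right_mono) auto
  also have "\<dots> < e"
    using \<open>e > 0\<close> \<open>z \<noteq> 0\<close> by simp
  finally have "t *\<^sub>R z \<in> K"
    using \<open>0 < t\<close> ball by (auto simp: dist_norm)
  then have "metric_projection K (t *\<^sub>R z) = t *\<^sub>R z"
    by (rule metric_projection_id[OF assms(1)])
  moreover have "metric_projection K (t *\<^sub>R z) = 0"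
    using nearest_points_segment[OF \<open>0 \<in> nearest_points K z\<close>, of t] \<open>0 < t\<close> \<open>t \<le> 1\<close>
    by (intro metric_projection_eqI[OF assms(1)]) simp
  ultimately show False
    using \<open>0 < t\<close> \<open>z \<noteq> 0\<close> by simp
qed

text \<open>An element of largest norm is the residual of its double, and a residual in \<open>K\<close> is zero.\<close>

lemma compact_bipotent_imp_trivial:
  assumes "chebyshev K" and "bipotent (metric_projection K)" and "compact K"
  shows "K = {0}"
proof -
  have "0 \<in> K"
    using zero_mem_bipotent assms(1,2) .
  then obtain m where "m \<in> K" and max: "\<And>k. k \<in> K \<Longrightarrow> norm k \<le> norm m"
    using continuous_attains_sup[OF assms(3), of norm] by (auto intro: continuous_intros)
  have "m \<in> nearest_points K (2 *\<^sub>R m)"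
  proof (rule nearest_pointsI[OF \<open>m \<in> K\<close>])
    fix k assume "k \<in> K"
    have "2 *\<^sub>R m - m = m"
      by (simp add: scaleR_2)
    then have "norm (2 *\<^sub>R m - m) = norm (2 *\<^sub>R m) - norm m"
      by simp
    also have "\<dots> \<le> norm (2 *\<^sub>R m) - norm k"
      using max[OF \<open>k \<in> K\<close>] by simp
    also have "\<dots> \<le> norm (2 *\<^sub>R m - k)"
      by (rule norm_triangle_ineq2)
    finally show "norm (2 *\<^sub>R m - m) \<le> norm (2 *\<^sub>R m - k)" .
  qed
  then have proj: "metric_projection K (2 *\<^sub>R m) = m"
    by (rule metric_projection_eqI[OF assms(1)])
  with \<open>m \<in> K\<close> have "2 *\<^sub>R m = m"
    using residual_mem_imp_zero[OF assms(1,2), of "2 *\<^sub>R m"] by (simp add: scaleR_2)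
  then have "m = 0"
    by (simp add: scaleR_2)
  with max \<open>0 \<in> K\<close> show ?thesis
    by auto
qed

theorem theorem3p2:
  fixes K :: "'a::complex_normed_vector set"
  assumes "chebyshev K"
    and "bipotent (metric_projection K)"
  shows "0 \<in> K
    \<and> (\<forall>x \<in> - K. x - metric_projection K x \<in> - K)
    \<and> (K \<noteq> UNIV \<longrightarrow> 0 \<notin> interior K)
    \<and> (K \<noteq> UNIV \<longrightarrow> 0 \<in> frontier K)
    \<and> (K \<noteq> {0} \<longrightarrow> complete K \<and> convex K \<longrightarrow> \<not> totally_bounded K)"
proof (intro conjI impI ballI)
  show zero: "0 \<in> K"
    using zero_mem_bipotent assms .
  show "x - metric_projection K x \<in> - K" if "x \<in> - K" for x
    using that residual_mem_imp_zero[OF assms, of x] metric_projection_mem[OF assms(1), of x]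
    by auto
  show interior: "0 \<notin> interior K" if "K \<noteq> UNIV"
    using zero_not_interior_bipotent assms that .
  show "0 \<in> frontier K" if "K \<noteq> UNIV"
    using zero interior[OF that] closure_subset by (auto simp: frontier_def)
  show "\<not> totally_bounded K" if "K \<noteq> {0}" and "complete K \<and> convex K"
  proof
    assume "totally_bounded K"
    with that(2) have "compact K"
      by (simp add: compact_eq_totally_bounded totally_bounded_metric ball_def)
    with that(1) show False
      using compact_bipotent_imp_trivial[OF assms] by simp
  qed
qed

end
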